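(* For every odd integer $k \ge 3$, $\mathrm{eqdim}(J_{2k,k}) = \frac{1}{2}\binom{2k}{k}$.
   Context: For positive integers $n > k$, the Johnson graph $J_{n,k}$ has as vertices all $k$-element subsets of $\{1,\dots,n\}$, two such subsets $A,B$ being adjacent iff $|A \cap B| = k-1$. In a connected graph $G$, $d(u,v)$ is the shortest-path distance. A subset $S \subseteq V(G)$ is a distance-equalizer set of $G$ if for every two distinct vertices $u,v \in V(G)\setminus S$ there exists $x \in S$ with $d(u,x) = d(v,x)$. The equidistant dimension $\mathrm{eqdim}(G)$ is the minimum cardinality of a distance-equalizer set of $G$. *)

theory Defs
  imports "Graph_Theory.Graph_Theory"
begin

definition johnson_graph :: "nat \<Rightarrow> nat \<Rightarrow> nat set pair_pre_digraph" where
  "johnson_graph n k =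
     (let V = {A. A \<subseteq> {1..n} \<and> card A = k}
      in \<lparr> pverts = V, parcs = {(A, B). A \<in> V \<and> B \<in> V \<and> card (A \<inter> B) = k - 1} \<rparr>)"

lemma pair_graph_johnson_graph:
  assumes "0 < k"
  shows "pair_graph (johnson_graph n k)"
proof -
  let ?V = "{A. A \<subseteq> {1..n} \<and> card A = k}"
  have V: "pverts (johnson_graph n k) = ?V"
    and E: "parcs (johnson_graph n k) =
      {(A, B). A \<in> ?V \<and> B \<in> ?V \<and> card (A \<inter> B) = k - 1}"
    by (simp_all add: johnson_graph_def)
  have fin: "finite ?V"
    by (rule finite_subset[of _ "Pow {1..n}"]) auto
  have "parcs (johnson_graph n k) \<subseteq> ?V \<times> ?V"
    unfolding E by blast
  then have "finite (parcs (johnson_graph n k))"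
    using fin by (meson finite_SigmaI finite_subset)
  moreover have "sym (parcs (johnson_graph n k))"
    unfolding E by (rule symI) (simp add: Int_commute)
  moreover have "fst e \<noteq> snd e" if "e \<in> parcs (johnson_graph n k)" for e
    using that assms unfolding E by (cases e) auto
  moreover have "fst e \<in> ?V" "snd e \<in> ?V" if "e \<in> parcs (johnson_graph n k)" for e
    using that unfolding E by (cases e; simp)+
  ultimately show ?thesis
    using fin by unfold_locales (simp_all only: V symmetric_def with_proj_simps not_False_eq_True)
qed

text \<open>Unit arc weights make the walk cost the number of arcs. The defining equation of the
  library constant is available for well-formed digraphs; unreachable pairs have distance
  \<open>\<infinity>\<close>.\<close>

definition graph_dist :: "('a, 'b) pre_digraph \<Rightarrow> 'a \<Rightarrow> 'a \<Rightarrow> ereal" where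
  "graph_dist G u v = wf_digraph.\<mu> G (\<lambda>_. 1) u v"

definition distance_equalizer_set :: "('a, 'b) pre_digraph \<Rightarrow> 'a set \<Rightarrow> bool" where
  "distance_equalizer_set G S \<longleftrightarrow>
     S \<subseteq> verts G \<and>
     (\<forall>u \<in> verts G - S. \<forall>v \<in> verts G - S. u \<noteq> v \<longrightarrow>
        (\<exists>x \<in> S. graph_dist G u x = graph_dist G v x))"

definition eqdim :: "('a, 'b) pre_digraph \<Rightarrow> nat" where
  "eqdim G = (LEAST m. \<exists>S. distance_equalizer_set G S \<and> finite S \<and> card S = m)"

end

theory Submission
  imports Defs
begin

text \<open>Distance in a Johnson graph is \<open>d(A, B) = |A - B|\<close>, so in \<open>J(2k, k)\<close> a vertex and its
  complement satisfy \<open>d(A, X) + d(A\<^sup>c, X) = k\<close>. For odd \<open>k\<close> no vertex is equidistant from a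
  complementary pair, so an equalizer set meets all such pairs and contains at least half of the
  vertices. Conversely, the vertices containing the point \<open>1\<close> form an equalizer set: if \<open>U\<close> and
  \<open>V\<close> avoid \<open>1\<close>, an equidistant vertex \<open>{1} \<union> Y\<close> is obtained by taking the \<open>k - 1\<close> (an even
  number) elements of \<open>Y\<close> either half from \<open>U - V\<close> and half from \<open>V - U\<close>, or all outside the
  symmetric difference of \<open>U\<close> and \<open>V\<close>.\<close>

section \<open>Vertices, arcs and distance in Johnson graphs\<close>

lemma pverts_johnson_graph:
  "pverts (johnson_graph n k) = {A. A \<subseteq> {1..n} \<and> card A = k}"
  by (simp add: johnson_graph_def)

lemma parcs_johnson_graph:
  "parcs (johnson_graph n k) = {(A, B). A \<in> pverts (johnson_graph n k) \<and>
     B \<in> pverts (johnson_graph n k) \<and> card (A \<inter> B) = k - 1}"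
  by (simp add: johnson_graph_def)

lemma finite_johnson_vertex: "A \<in> pverts (johnson_graph n k) \<Longrightarrow> finite A"
  by (auto simp: pverts_johnson_graph intro: finite_subset)

lemma card_johnson_vertex: "A \<in> pverts (johnson_graph n k) \<Longrightarrow> card A = k"
  by (simp add: pverts_johnson_graph)

lemma finite_pverts_johnson_graph: "finite (pverts (johnson_graph n k))"
  by (rule finite_subset[of _ "Pow {1..n}"]) (auto simp: pverts_johnson_graph)

lemma card_pverts_johnson_graph: "card (pverts (johnson_graph n k)) = n choose k"
  by (simp add: pverts_johnson_graph n_subsets)

lemma wf_digraph_johnson_graph: "wf_digraph (with_proj (johnson_graph n k))"
  by unfold_locales (auto simp: parcs_johnson_graph)

text \<open>An arc exchanges a single element of the current vertex, so the number of elements still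
  missing from \<open>B\<close> drops by at most one per arc.\<close>

lemma johnson_walk_length_ge:
  assumes "0 < k" and "pre_digraph.awalk (with_proj (johnson_graph n k)) A p B"
  shows "card (A - B) \<le> length p"
proof -
  interpret wf_digraph "with_proj (johnson_graph n k)"
    by (rule wf_digraph_johnson_graph)
  show ?thesis
    using assms(2)
  proof (induction p arbitrary: A)
    case Nil
    then show ?case by (simp add: awalk_Nil_iff)
  next
    case (Cons e p)
    obtain C where e: "e = (A, C)" and AC: "(A, C) \<in> parcs (johnson_graph n k)"
      and C: "awalk C p B"
      using Cons.prems by (cases e) (auto simp: awalk_Cons_iff)
    have A: "finite A" "card A = k" and fC: "finite C" and "card (A \<inter> C) = k - 1"
      using AC by (auto simp: parcs_johnson_graph finite_johnson_vertex card_johnson_vertex)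
    \<comment> \<open>Subtraction is truncated: \<open>k - (k - 1)\<close> is 1 only because
      \<open>k\<close> is positive.\<close>
    then have "card (A - C) = 1"
      using \<open>0 < k\<close> by (simp add: card_Diff_subset_Int)
    moreover have "card (A - B) \<le> card ((A - C) \<union> (C - B))"
      using A fC by (intro card_mono) auto
    moreover have "card ((A - C) \<union> (C - B)) \<le> card (A - C) + card (C - B)"
      by (rule card_Un_le)
    ultimately show ?case
      using Cons.IH[OF C] by simp
  qed
qed

text \<open>Swapping an element of \<open>A - B\<close> for one of \<open>B - A\<close> is an arc
  that brings the vertex one element closer to \<open>B\<close>; repeating this attains the lower
  bound on walk lengths.\<close>

lemma johnson_walk_exists:
  assumes "A \<in> pverts (johnson_graph n k)" and "B \<in> pverts (johnson_graph n k)"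
  shows "\<exists>p. pre_digraph.awalk (with_proj (johnson_graph n k)) A p B \<and> length p = card (A - B)"
proof -
  interpret wf_digraph "with_proj (johnson_graph n k)"
    by (rule wf_digraph_johnson_graph)
  note B = finite_johnson_vertex[OF assms(2)] card_johnson_vertex[OF assms(2)]
  show ?thesis
    using assms(1)
  proof (induction "card (A - B)" arbitrary: A)
    case 0
    note A = finite_johnson_vertex[OF 0(2)] card_johnson_vertex[OF 0(2)]
    have "A \<subseteq> B" using 0 A by auto
    then have "A = B" using A B by (simp add: card_subset_eq)
    then show ?case
      using 0 by (intro exI[of _ "[]"]) (simp add: awalk_Nil_iff)
  next
    case (Suc m)
    note A = finite_johnson_vertex[OF Suc.prems] card_johnson_vertex[OF Suc.prems]
    \<comment> \<open>Equal cardinality of \<open>A\<close> and \<open>B\<close> makes both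
      differences nonempty, so an exchange is possible.\<close>
    have "card (A - B) = card (B - A)"
      using A B by (simp add: card_Diff_subset_Int Int_commute)
    then obtain a b where ab: "a \<in> A" "a \<notin> B" "b \<in> B" "b \<notin> A"
      using Suc.hyps(2) by (metis DiffE card.empty ex_in_conv nat.distinct(1))
    define C where "C = insert b (A - {a})"
    have AB: "A \<subseteq> {1..n}" "B \<subseteq> {1..n}"
      using Suc.prems assms(2) by (auto simp: pverts_johnson_graph)
    have "card A > 0" using A ab by (auto simp: card_gt_0_iff)
    then have C: "C \<in> pverts (johnson_graph n k)"
      using A AB ab by (auto simp: C_def pverts_johnson_graph card_insert_if)
    have "A \<inter> C = A - {a}" using ab by (auto simp: C_def)
    then have "(A, C) \<in> parcs (johnson_graph n k)"
      using Suc.prems C A ab by (simp add: parcs_johnson_graph)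
    moreover have "C - B = (A - B) - {a}" using ab by (auto simp: C_def)
    then have "m = card (C - B)" using Suc.hyps(2) ab A by simp
    then obtain p where "awalk C p B" "length p = m"
      using Suc.hyps(1)[OF _ C] by auto
    ultimately show ?case
      using Suc.hyps(2) by (intro exI[of _ "(A, C) # p"]) (simp add: awalk_Cons_iff)
  qed
qed

lemma graph_dist_johnson_graph:
  assumes "0 < k" and "A \<in> pverts (johnson_graph n k)" and "B \<in> pverts (johnson_graph n k)"
  shows "graph_dist (with_proj (johnson_graph n k)) A B = ereal (real (card (A - B)))"
proof -
  interpret wf_digraph "with_proj (johnson_graph n k)"
    by (rule wf_digraph_johnson_graph)
  have cost: "awalk_cost (\<lambda>_. 1) p = real (length p)" for p
    by (induction p) auto
  obtain p where "awalk A p B" "length p = card (A - B)"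
    using johnson_walk_exists[OF assms(2,3)] by blast
  then have "\<mu> (\<lambda>_. 1) A B \<le> ereal (real (card (A - B)))"
    using min_cost_le_walk_cost[of A p B "\<lambda>_. 1"] by (simp add: cost)
  \<comment> \<open>\<open>\<mu>\<close> is the infimum of the walk costs, so the bound for every
    single walk passes to it.\<close>
  moreover have "ereal (real (card (A - B))) \<le> \<mu> (\<lambda>_. 1) A B"
    unfolding \<mu>_def
    using johnson_walk_length_ge[OF \<open>0 < k\<close>] by (intro INF_greatest) (simp add: cost)
  ultimately show ?thesis
    by (simp add: graph_dist_def)
qed

section \<open>Subsets that meet two given sets equally\<close>

lemma exists_subset_equal_intersections:
  fixes W :: "'a set"
  assumes "finite W" "U \<subseteq> W" "V \<subseteq> W" "card U = card V" "4 * m \<le> card W + 2"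
  shows "\<exists>Y \<subseteq> W. card Y = 2 * m \<and> card (U \<inter> Y) = card (V \<inter> Y)"
proof -
  have fin: "finite U" "finite V"
    using assms finite_subset by auto
  have diff: "card (V - U) = card (U - V)"
    using fin \<open>card U = card V\<close> by (simp add: card_Diff_subset_Int Int_commute)
  show ?thesis
  proof (cases "m \<le> card (U - V)")
    case True
    \<comment> \<open>\<open>P\<close> meets only \<open>U\<close> and \<open>Q\<close> only
      \<open>V\<close>, so their union contributes \<open>m\<close> elements to each.\<close>
    obtain P where P: "P \<subseteq> U - V" "card P = m" "finite P"
      using True obtain_subset_with_card_n by blast
    obtain Q where Q: "Q \<subseteq> V - U" "card Q = m" "finite Q"
      using True diff obtain_subset_with_card_n by metis
    have "U \<inter> (P \<union> Q) = P" "V \<inter> (P \<union> Q) = Q" "P \<inter> Q = {}"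
      using P Q by auto
    then show ?thesis
      using P Q assms by (intro exI[of _ "P \<union> Q"]) (auto simp: card_Un_disjoint)
  next
    case False
    let ?D = "(U - V) \<union> (V - U)"
    have "card ?D = 2 * card (U - V)"
      using fin diff by (subst card_Un_disjoint) auto
    moreover have "card (W - ?D) = card W - card ?D"
      using fin assms by (intro card_Diff_subset) auto
    \<comment> \<open>Now the symmetric difference has at most 2(m - 1) elements, which is where the
      summand 2 in the hypothesis on \<open>card W\<close> comes from.\<close>
    ultimately have "2 * m \<le> card (W - ?D)"
      using False assms(5) by linarith
    then obtain Y where Y: "Y \<subseteq> W - ?D" "card Y = 2 * m"
      using obtain_subset_with_card_n by metis
    then have "U \<inter> Y = V \<inter> Y" by auto
    then show ?thesis using Y by auto
  qed
qed

section \<open>Complementary pairs and the equidistant dimension of J(2k, k)\<close>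

context
  fixes k :: nat and J :: "nat set pair_pre_digraph" and compl :: "nat set \<Rightarrow> nat set"
  defines "J \<equiv> johnson_graph (2 * k) k" and "compl \<equiv> \<lambda>A. {1..2 * k} - A"
begin

lemma compl_vertex: "A \<in> pverts J \<Longrightarrow> compl A \<in> pverts J"
  using finite_johnson_vertex[of A "2 * k" k]
  by (auto simp: J_def compl_def pverts_johnson_graph card_Diff_subset)

lemma compl_compl: "A \<in> pverts J \<Longrightarrow> compl (compl A) = A"
  by (auto simp: J_def compl_def pverts_johnson_graph)

text \<open>The two differences partition \<open>compl X\<close>, which has \<open>k\<close>
  elements.\<close>

lemma card_diff_compl:
  assumes "A \<in> pverts J" and "X \<in> pverts J"
  shows "card (A - X) + card (compl A - X) = k"
proof -
  have "compl A - X = compl X - A" by (auto simp: compl_def)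
  moreover have "A - X = A \<inter> compl X"
    using assms by (auto simp: J_def compl_def pverts_johnson_graph)
  moreover have "card (compl X) = k" "finite (compl X)"
    using compl_vertex[OF assms(2)] by (simp_all add: J_def card_johnson_vertex compl_def)
  ultimately show ?thesis
    using card_Int_Diff[of "compl X" A] by (simp add: Int_commute)
qed

lemma card_distance_equalizer_set_ge:
  assumes "odd k" and "distance_equalizer_set (with_proj J) S"
  shows "(2 * k) choose k \<le> 2 * card S"
proof -
  have "0 < k" using \<open>odd k\<close> by (rule odd_pos)
  have S: "S \<subseteq> pverts J" and eq: "\<And>u v. u \<in> pverts J - S \<Longrightarrow> v \<in> pverts J - S \<Longrightarrow> u \<noteq> v \<Longrightarrow>
      \<exists>x \<in> S. graph_dist (with_proj J) u x = graph_dist (with_proj J) v x"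
    using assms(2) by (auto simp: distance_equalizer_set_def)
  have "finite S"
    using S finite_pverts_johnson_graph by (auto simp: J_def intro: finite_subset)
  have "A \<in> S \<union> compl ` S" if A: "A \<in> pverts J" for A
  proof (rule ccontr)
    assume *: "A \<notin> S \<union> compl ` S"
    then have "compl A \<notin> S"
      using compl_compl[OF A] by (metis UnI2 image_eqI)
    \<comment> \<open>A vertex equal to its complement would make both summands of
      \<open>card_diff_compl\<close> at \<open>X = A\<close> zero, although they add up to
      \<open>k\<close>.\<close>
    moreover have "compl A \<noteq> A"
      using card_diff_compl[OF A A] \<open>0 < k\<close> by auto
    ultimately obtain x where x: "x \<in> S"
      "graph_dist (with_proj J) A x = graph_dist (with_proj J) (compl A) x"
      using eq[of A "compl A"] compl_vertex[OF A] A * by auto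
    then have "x \<in> pverts J" using S by auto
    then have "card (A - x) = card (compl A - x)"
      using x(2) A compl_vertex[OF A] \<open>0 < k\<close> by (simp add: J_def graph_dist_johnson_graph)
    then have "even k"
      using card_diff_compl[OF A \<open>x \<in> pverts J\<close>] by presburger
    then show False using \<open>odd k\<close> by simp
  qed
  then have "card (pverts J) \<le> card (S \<union> compl ` S)"
    using \<open>finite S\<close> by (intro card_mono) auto
  also have "\<dots> \<le> card S + card (compl ` S)" by (rule card_Un_le)
  also have "\<dots> \<le> 2 * card S" using card_image_le[OF \<open>finite S\<close>, of compl] by simp
  finally show ?thesis by (simp add: J_def card_pverts_johnson_graph)
qed

text \<open>Complementation is a bijection between the vertices containing 1 and those avoiding
  1.\<close>

lemma card_star:
  assumes "0 < k"
  shows "2 * card {A \<in> pverts J. 1 \<in> A} = (2 * k) choose k"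
proof -
  let ?S = "{A \<in> pverts J. 1 \<in> A}"
  have fin: "finite ?S"
    using finite_pverts_johnson_graph by (simp add: J_def)
  have "A \<in> ?S \<union> compl ` ?S" if A: "A \<in> pverts J" for A
  proof (cases "1 \<in> A")
    case False
    then have "1 \<in> compl A" using assms by (simp add: compl_def)
    then show ?thesis
      using compl_vertex[OF A] compl_compl[OF A, symmetric] by blast
  qed (use A in simp)
  then have V: "pverts J = ?S \<union> compl ` ?S"
    using compl_vertex by blast
  have "?S \<inter> compl ` ?S = {}"
    by (auto simp: compl_def)
  moreover have "inj_on compl ?S"
    by (rule inj_on_inverseI[where g = compl]) (simp add: compl_compl)
  ultimately have "card (?S \<union> compl ` ?S) = 2 * card ?S"
    using fin by (simp add: card_Un_disjoint card_image)
  then show ?thesis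
    unfolding V[symmetric] by (simp add: J_def card_pverts_johnson_graph)
qed

lemma distance_equalizer_set_star:
  assumes "odd k"
  shows "distance_equalizer_set (with_proj J) {A \<in> pverts J. 1 \<in> A}"
proof -
  have "\<exists>X \<in> pverts J. 1 \<in> X \<and> graph_dist (with_proj J) U X = graph_dist (with_proj J) V X"
    if U: "U \<in> pverts J" "1 \<notin> U" and V: "V \<in> pverts J" "1 \<notin> V" for U V
  proof -
    obtain m where m: "k = 2 * m + 1" using \<open>odd k\<close> by (rule oddE)
    have UV: "card U = k" "card V = k" "finite U" "finite V"
      using U V by (simp_all add: J_def card_johnson_vertex finite_johnson_vertex)
    have "{1..2 * k} - {1} = {2..2 * k}" by auto
    then have "U \<subseteq> {2..2 * k}" "V \<subseteq> {2..2 * k}"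
      using U V unfolding J_def pverts_johnson_graph by blast+
    \<comment> \<open>With k = 2m + 1 the set \<open>{2..2 * k}\<close> has 4m + 1 elements, enough
      for the size condition.\<close>
    then obtain Y where Y: "Y \<subseteq> {2..2 * k}" "card Y = 2 * m" "card (U \<inter> Y) = card (V \<inter> Y)"
      using exists_subset_equal_intersections[of "{2..2 * k}" U V m] UV m by auto
    have "finite Y" "1 \<notin> Y" using Y(1) by (auto intro: finite_subset)
    then have X: "insert 1 Y \<in> pverts J"
      using Y m by (auto simp: J_def pverts_johnson_graph)
    \<comment> \<open>Adding 1 completes \<open>Y\<close> to a vertex of the star without touching
      \<open>U\<close> or \<open>V\<close>; as these have equal size, equal intersections give equal
      differences, hence equal distances.\<close>
    have "U \<inter> insert 1 Y = U \<inter> Y" "V \<inter> insert 1 Y = V \<inter> Y"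
      using U V by auto
    then have "card (U - insert 1 Y) = card (V - insert 1 Y)"
      using UV Y(3) by (simp add: card_Diff_subset_Int)
    then show ?thesis
      using X U V m by (intro bexI[OF _ X]) (simp add: J_def graph_dist_johnson_graph)
  qed
  then show ?thesis
    by (auto simp: distance_equalizer_set_def)
qed

text \<open>Stated in doubled form to avoid division of natural numbers.\<close>

lemma eqdim_johnson_graph_double:
  assumes "odd k"
  shows "2 * eqdim (with_proj J) = (2 * k) choose k"
proof -
  let ?S = "{A \<in> pverts J. 1 \<in> A}"
  note star = card_star[OF odd_pos[OF assms]]
  have "finite ?S"
    using finite_pverts_johnson_graph by (simp add: J_def)
  have "eqdim (with_proj J) = card ?S"
    unfolding eqdim_def
  proof (rule Least_equality)
    show "\<exists>S. distance_equalizer_set (with_proj J) S \<and> finite S \<and> card S = card ?S"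
      using distance_equalizer_set_star[OF assms] \<open>finite ?S\<close> by blast
  next
    fix m
    assume "\<exists>S. distance_equalizer_set (with_proj J) S \<and> finite S \<and> card S = m"
    then show "card ?S \<le> m"
      using card_distance_equalizer_set_ge[OF assms] star by fastforce
  qed
  then show ?thesis using star by simp
qed

end

theorem theorem5:
  fixes k :: nat
  assumes "odd k" and "k \<ge> 3"
  shows "real (eqdim (with_proj (johnson_graph (2 * k) k))) = 1 / 2 * real ((2 * k) choose k)"
  unfolding eqdim_johnson_graph_double[OF assms(1), symmetric] by simp

end
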